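(* Let $\Pi$ be a finite projective plane of odd order $n$. Let $\infty$ be a point of $\Pi$, and suppose there is an oval $C$ of $\Pi$ such that $\infty \in C$. Then the un-ordered extremal triple array $\mathbb{A}(\Pi,\infty)$ is orderable. That is, there is an $(n+1)\times n^2$ extremal triple array $A$ (on $n(n+1)$ symbols, namely the points of $\Pi$ other than $\infty$) such that $\mathbb{A}(\Pi,\infty)$ is the pair of marginals of $A$: the symbol sets of the $n+1$ rows of $A$ are precisely the complements, in the point set of $\Pi$, of the $n+1$ lines of $\Pi$ through $\infty$ (each occurring for exactly one row), and the symbol sets of the $n^2$ columns of $A$ are precisely the $n^2$ lines of $\Pi$ not passing through $\infty$ (each occurring for exactly one column).
   Context: A projective plane of order $n$ ($n\ge 2$) is a $2$-$(n^2+n+1,n+1,1)$ design, whose blocks are called lines; lines are identified with their sets of points. An oval in a projective plane of order $n$ is a set of $n+1$ points, no three of which are collinear. For integers $p,q\ge 2$, $v\ge 1$, a $p\times q$ triple array on $v$ symbols is an allocation $A$ of $v$ symbols to the $pq$ positions of a $p\times q$ grid such that: (i) the symbols in each row are distinct and the symbols in each column are distinct ($A$ is binary); (ii) each symbol occurs in the same number $r=pq/v$ of positions (equi-replicate); and there are constants $\lambda_{RR},\lambda_{CC},\lambda_{RC}$ such that any two distinct rows have exactly $\lambda_{RR}$ common symbols, any two distinct columns have exactly $\lambda_{CC}$ common symbols, and any row and any column have exactly $\lambda_{RC}$ common symbols. It is extremal if $v=p+q-1$. For a binary array $A$, the row design $D_R^A$ (respectively column design $D_C^A$) is the block design whose points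 are the symbols of $A$ and which has one block for each row (respectively column), namely the set of symbols occurring in it. The pair $(D_R^A,D_C^A)$ is the pair of marginals of $A$. $\mathbb{A}(\Pi,\infty)$ denotes the pair $(D_R,D_C)$ of block designs on the $n^2+n$ points of $\Pi$ different from $\infty$, where the blocks of $D_R$ are the complements (in the point set of $\Pi$) of the lines of $\Pi$ through $\infty$, and the blocks of $D_C$ are the lines of $\Pi$ not passing through $\infty$. It is called orderable if there is a triple array $A$ with $D_R^A=D_R$ and $D_C^A=D_C$. *)

theory Defs
  imports "HOL-Library.Multiset"
begin

(* Blocks form a multiset: an array may have several rows (or columns) with the same symbol
   set, and its row (column) design has one block for each of them. *)
record 'a block_design =
  points :: "'a set"
  blocks :: "'a set multiset"

definition block_design :: "'a block_design \<Rightarrow> bool" where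
  "block_design D \<longleftrightarrow> finite (points D) \<and> (\<forall>b \<in># blocks D. b \<subseteq> points D)"

definition two_design :: "nat \<Rightarrow> nat \<Rightarrow> nat \<Rightarrow> 'a block_design \<Rightarrow> bool" where
  "two_design v k lam D \<longleftrightarrow>
     block_design D \<and>
     card (points D) = v \<and>
     (\<forall>b \<in># blocks D. card b = k) \<and>
     (\<forall>x \<in> points D. \<forall>y \<in> points D. x \<noteq> y \<longrightarrow>
        size {# b \<in># blocks D. x \<in> b \<and> y \<in> b #} = lam)"

definition projective_plane :: "nat \<Rightarrow> 'a block_design \<Rightarrow> bool" where
  "projective_plane n \<Pi> \<longleftrightarrow> n \<ge> 2 \<and> two_design (n\<^sup>2 + n + 1) (n + 1) 1 \<Pi>"

abbreviation lines :: "'a block_design \<Rightarrow> 'a set set" where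
  "lines \<Pi> \<equiv> set_mset (blocks \<Pi>)"

definition collinear3 :: "'a block_design \<Rightarrow> 'a \<Rightarrow> 'a \<Rightarrow> 'a \<Rightarrow> bool" where
  "collinear3 \<Pi> x y z \<longleftrightarrow> (\<exists>l \<in> lines \<Pi>. x \<in> l \<and> y \<in> l \<and> z \<in> l)"

definition oval :: "nat \<Rightarrow> 'a block_design \<Rightarrow> 'a set \<Rightarrow> bool" where
  "oval n \<Pi> C \<longleftrightarrow>
     C \<subseteq> points \<Pi> \<and> card C = n + 1 \<and>
     (\<forall>x \<in> C. \<forall>y \<in> C. \<forall>z \<in> C. x \<noteq> y \<and> x \<noteq> z \<and> y \<noteq> z \<longrightarrow> \<not> collinear3 \<Pi> x y z)"

(* A p x q array is a function A of which only the values A i j with i < p and j < q matter. *)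
type_synonym 'a arr = "nat \<Rightarrow> nat \<Rightarrow> 'a"

definition row_symbols :: "nat \<Rightarrow> 'a arr \<Rightarrow> nat \<Rightarrow> 'a set" where
  "row_symbols q A i = {A i j | j. j < q}"

definition col_symbols :: "nat \<Rightarrow> 'a arr \<Rightarrow> nat \<Rightarrow> 'a set" where
  "col_symbols p A j = {A i j | i. i < p}"

definition symbols :: "nat \<Rightarrow> nat \<Rightarrow> 'a arr \<Rightarrow> 'a set" where
  "symbols p q A = {A i j | i j. i < p \<and> j < q}"

definition binary_array :: "nat \<Rightarrow> nat \<Rightarrow> 'a arr \<Rightarrow> bool" where
  "binary_array p q A \<longleftrightarrow>
     (\<forall>i < p. inj_on (\<lambda>j. A i j) {..<q}) \<and> (\<forall>j < q. inj_on (\<lambda>i. A i j) {..<p})"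

definition equireplicate :: "nat \<Rightarrow> nat \<Rightarrow> 'a arr \<Rightarrow> bool" where
  "equireplicate p q A \<longleftrightarrow>
     (\<exists>r. r * card (symbols p q A) = p * q \<and>
        (\<forall>s \<in> symbols p q A. card {(i, j). i < p \<and> j < q \<and> A i j = s} = r))"

definition triple_array :: "nat \<Rightarrow> nat \<Rightarrow> nat \<Rightarrow> 'a arr \<Rightarrow> bool" where
  "triple_array p q v A \<longleftrightarrow>
     p \<ge> 2 \<and> q \<ge> 2 \<and> v \<ge> 1 \<and>
     card (symbols p q A) = v \<and>
     binary_array p q A \<and>
     equireplicate p q A \<and>
     (\<exists>lamRR. \<forall>i < p. \<forall>i' < p. i \<noteq> i' \<longrightarrow>
        card (row_symbols q A i \<inter> row_symbols q A i') = lamRR) \<and>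
     (\<exists>lamCC. \<forall>j < q. \<forall>j' < q. j \<noteq> j' \<longrightarrow>
        card (col_symbols p A j \<inter> col_symbols p A j') = lamCC) \<and>
     (\<exists>lamRC. \<forall>i < p. \<forall>j < q.
        card (row_symbols q A i \<inter> col_symbols p A j) = lamRC)"

definition extremal_triple_array :: "nat \<Rightarrow> nat \<Rightarrow> nat \<Rightarrow> 'a arr \<Rightarrow> bool" where
  "extremal_triple_array p q v A \<longleftrightarrow> triple_array p q v A \<and> v = p + q - 1"

definition row_design :: "nat \<Rightarrow> nat \<Rightarrow> 'a arr \<Rightarrow> 'a block_design" where
  "row_design p q A =
     \<lparr> points = symbols p q A, blocks = image_mset (row_symbols q A) (mset_set {..<p}) \<rparr>"

definition col_design :: "nat \<Rightarrow> nat \<Rightarrow> 'a arr \<Rightarrow> 'a block_design" where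
  "col_design p q A =
     \<lparr> points = symbols p q A, blocks = image_mset (col_symbols p A) (mset_set {..<q}) \<rparr>"

definition marginals :: "nat \<Rightarrow> nat \<Rightarrow> 'a arr \<Rightarrow> 'a block_design \<times> 'a block_design" where
  "marginals p q A = (row_design p q A, col_design p q A)"

(* The pair written A(Pi, infinity) in the literature. *)
definition unordered_array :: "'a block_design \<Rightarrow> 'a \<Rightarrow> 'a block_design \<times> 'a block_design" where
  "unordered_array \<Pi> pt =
     (\<lparr> points = points \<Pi> - {pt},
        blocks = image_mset (\<lambda>l. points \<Pi> - l) {# l \<in># blocks \<Pi>. pt \<in> l #} \<rparr>,
      \<lparr> points = points \<Pi> - {pt},
        blocks = {# l \<in># blocks \<Pi>. pt \<notin> l #} \<rparr>)"

definition orderable :: "'a block_design \<times> 'a block_design \<Rightarrow> bool" where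
  "orderable DD \<longleftrightarrow> (\<exists>p q v A. triple_array p q v A \<and> marginals p q A = DD)"

end

(* A triple array with these marginals amounts to a colouring of the flags (Q, m), m a line not
   through pt, by lines of the pencil of pt, such that the colour of (Q, m) avoids Q and
   different flags with the same line or the same point get different colours. The lines of the
   pencil correspond to the points of the oval C, the tangent at pt belonging to pt itself, so it
   suffices to choose points of C. As n is odd, a point other than a on the tangent at a lies on
   exactly one further tangent (Qvist); the colours are read off from such second tangents. *)

theory Submission
  imports Defs
begin

text \<open>The counts leave no slack: a line off \<open>pt\<close> has \<open>n + 1\<close> points
  for \<open>n + 1\<close> colours, and a point other than \<open>pt\<close> has \<open>n\<close>
  such lines for the \<open>n\<close> colours that avoid it. Fix \<open>a\<close> in
  \<open>C - {pt}\<close> and let \<open>x\<close> be the oval point whose pencil line carries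
  \<open>Q\<close>. The meet of that line with the tangent at \<open>a\<close> lies on a second
  tangent (unless it is \<open>a\<close> itself), whose contact point \<open>third x a\<close> is
  the basic colour of \<open>Q\<close>. Given \<open>a\<close> it determines \<open>x\<close>, and
  given \<open>x\<close> other than \<open>pt\<close> it determines \<open>a\<close>. So one
  \<open>a\<close> can serve all of \<open>m\<close>, while the lines through \<open>Q\<close> need
  distinct \<open>a\<close>; therefore \<open>a\<close> is a bijective function of the point where
  \<open>m\<close> meets the tangent at \<open>pt\<close>. The rule yields the forbidden
  \<open>x\<close> itself exactly for \<open>x = a\<close> and \<open>x = pt\<close>. Exchanging
  these two colours would do along \<open>m\<close>, but a point on the tangent at \<open>pt\<close>
  would then get the same colour on all its lines, as they share \<open>a\<close>. Hence a rotation
  of three colours that also involves the meet of \<open>m\<close> with the tangent at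
  \<open>a\<close>: its basic colour varies with \<open>m\<close> and goes to the point on the
  tangent at \<open>pt\<close>.\<close>

section \<open>Counting points and lines in a projective plane\<close>

locale proj_plane =
  fixes P :: "'a set" and Ls :: "'a set set" and n :: nat
  assumes finP: "finite P" and n2: "n \<ge> 2" and cardP: "card P = n\<^sup>2 + n + 1"
    and subP: "l \<in> Ls \<Longrightarrow> l \<subseteq> P" and cardl: "l \<in> Ls \<Longrightarrow> card l = n + 1"
    and ex_line: "\<lbrakk>x \<in> P; y \<in> P; x \<noteq> y\<rbrakk> \<Longrightarrow> \<exists>l\<in>Ls. x \<in> l \<and> y \<in> l"
    and line_unique:
      "\<lbrakk>l \<in> Ls; m \<in> Ls; x \<noteq> y; x \<in> l; y \<in> l; x \<in> m; y \<in> m\<rbrakk> \<Longrightarrow> l = m"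
begin

lemma finLs: "finite Ls"
  using finP subP by (metis PowI finite_Pow_iff finite_subset subsetI)

lemma finl: "l \<in> Ls \<Longrightarrow> finite l"
  using finP subP finite_subset by blast

lemma card_pencil:
  assumes "x \<in> P" shows "card {l \<in> Ls. x \<in> l} = n + 1"
proof -
  let ?S = "{l \<in> Ls. x \<in> l}"
  have eq: "P - {x} = (\<Union>l\<in>?S. l - {x})"
    using ex_line[OF assms] subP by fast
  have "card (P - {x}) = (\<Sum>l\<in>?S. card (l - {x}))"
    unfolding eq
  proof (rule card_UN_disjoint)
    show "\<forall>l\<in>?S. \<forall>m\<in>?S. l \<noteq> m \<longrightarrow> (l - {x}) \<inter> (m - {x}) = {}"
      using line_unique by fast
  qed (use finLs finl in auto)
  also have "\<dots> = (\<Sum>l\<in>?S. n)"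
    using cardl finl by (intro sum.cong) auto
  finally have "n\<^sup>2 + n = card ?S * n"
    using assms finP cardP by simp
  then have "n * (n + 1) = n * card ?S"
    by (simp add: power2_eq_square algebra_simps)
  then show ?thesis using n2 by (subst (asm) mult_cancel1) auto
qed

text \<open>Joining a point \<open>x\<close> of \<open>m\<close> outside \<open>l\<close> to the
  \<open>n + 1\<close> points of \<open>l\<close> gives \<open>n + 1\<close> different lines, which
  is the whole pencil at \<open>x\<close>; so \<open>m\<close> is one of these joins.\<close>

lemma lines_meet:
  assumes "l \<in> Ls" "m \<in> Ls" shows "\<exists>p. p \<in> l \<and> p \<in> m"
proof -
  have "m \<noteq> {}" using cardl[OF assms(2)] by auto
  then obtain x where x: "x \<in> m" by blast
  show ?thesis
  proof (cases "x \<in> l")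
    case False
    have xP: "x \<in> P" using x assms subP by blast
    define j where "j y = (SOME k. k \<in> Ls \<and> x \<in> k \<and> y \<in> k)" for y
    have j: "j y \<in> Ls \<and> x \<in> j y \<and> y \<in> j y" if "y \<in> l" for y
    proof -
      have "\<exists>k. k \<in> Ls \<and> x \<in> k \<and> y \<in> k"
        using ex_line[OF xP, of y] that False subP assms(1) by blast
      then show ?thesis unfolding j_def by (rule someI_ex)
    qed
    have "inj_on j l"
      using j line_unique False assms(1) unfolding inj_on_def by metis
    then have "card (j ` l) = card {k \<in> Ls. x \<in> k}"
      using card_image cardl assms(1) card_pencil[OF xP] by metis
    then have "j ` l = {k \<in> Ls. x \<in> k}"
      using j finLs by (intro card_subset_eq) auto
    then have "m \<in> j ` l" using x assms(2) by blast
    then show ?thesis using j by blast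
  qed (use x in blast)
qed

definition meet :: "'a set \<Rightarrow> 'a set \<Rightarrow> 'a" where
  "meet l m = (SOME p. p \<in> l \<and> p \<in> m)"

lemma meet_in: "l \<in> Ls \<Longrightarrow> m \<in> Ls \<Longrightarrow> meet l m \<in> l \<and> meet l m \<in> m"
  unfolding meet_def by (rule someI_ex) (rule lines_meet)

text \<open>A line missing \<open>x\<close> meets a fixed line \<open>t\<close> through
  \<open>x\<close> in exactly one of its \<open>n\<close> other points, and each of these carries
  \<open>n\<close> lines besides \<open>t\<close>.\<close>

lemma card_antipencil:
  assumes "x \<in> P" shows "card {l \<in> Ls. x \<notin> l} = n\<^sup>2"
proof -
  have "{l \<in> Ls. x \<in> l} \<noteq> {}" using card_pencil[OF assms] by (metis add_is_0 card.empty one_neq_zero)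
  then obtain t where t: "t \<in> Ls" "x \<in> t" by blast
  let ?S = "\<lambda>p. {l \<in> Ls. p \<in> l} - {t}"
  have eq: "{l \<in> Ls. x \<notin> l} = (\<Union>p\<in>t - {x}. ?S p)"
  proof (intro equalityI subsetI)
    fix l assume "l \<in> {l \<in> Ls. x \<notin> l}"
    then show "l \<in> (\<Union>p\<in>t - {x}. ?S p)" using lines_meet[OF t(1), of l] t(2) by blast
  next
    fix l assume "l \<in> (\<Union>p\<in>t - {x}. ?S p)"
    then show "l \<in> {l \<in> Ls. x \<notin> l}" using line_unique[OF t(1), of l] t(2) by blast
  qed
  have "card {l \<in> Ls. x \<notin> l} = (\<Sum>p\<in>t - {x}. card (?S p))"
    unfolding eq
  proof (rule card_UN_disjoint)
    show "\<forall>p\<in>t - {x}. \<forall>q\<in>t - {x}. p \<noteq> q \<longrightarrow> ?S p \<inter> ?S q = {}"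
      using line_unique[OF t(1)] by fast
  qed (use finLs finl t in auto)
  also have "\<dots> = (\<Sum>p\<in>t - {x}. n)"
  proof (rule sum.cong)
    fix p assume "p \<in> t - {x}"
    then have "p \<in> P" "t \<in> {l \<in> Ls. p \<in> l}" using t subP by auto
    then show "card (?S p) = n" using card_pencil[of p] finLs by (subst card_Diff_singleton) auto
  qed simp
  also have "\<dots> = n\<^sup>2"
    using t cardl finl by (simp add: power2_eq_square)
  finally show ?thesis .
qed

section \<open>From a flag colouring to a triple array\<close>

text \<open>The \<open>n + 1\<close> colours on a line \<open>m\<close> off \<open>pt\<close> fill
  the pencil, so the cell in row \<open>l\<close> and column \<open>m\<close> can hold the point of
  \<open>m\<close> coloured \<open>l\<close>. Injectivity at a point makes rows repetition-free;
  avoidance puts row \<open>l\<close> inside \<open>P - l\<close>, which has the same size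
  \<open>n^2\<close>. The intersection constants then depend only on the plane.\<close>

lemma array_of_flag_colouring:
  fixes F :: "'a \<Rightarrow> 'a set \<Rightarrow> 'a set"
  assumes pt: "pt \<in> P"
    and F: "\<And>Q m. \<lbrakk>m \<in> Ls; pt \<notin> m; Q \<in> m\<rbrakk> \<Longrightarrow> F Q m \<in> Ls \<and> pt \<in> F Q m \<and> Q \<notin> F Q m"
    and inj_line: "\<And>m. \<lbrakk>m \<in> Ls; pt \<notin> m\<rbrakk> \<Longrightarrow> inj_on (\<lambda>Q. F Q m) m"
    and inj_point: "\<And>Q. inj_on (F Q) {m \<in> Ls. pt \<notin> m \<and> Q \<in> m}"
  shows "\<exists>A. extremal_triple_array (n + 1) (n\<^sup>2) (n * (n + 1)) A \<and>
         symbols (n + 1) (n\<^sup>2) A = P - {pt} \<and>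
         bij_betw (row_symbols (n\<^sup>2) A) {..<n + 1} {P - l | l. l \<in> Ls \<and> pt \<in> l} \<and>
         bij_betw (col_symbols (n + 1) A) {..<n\<^sup>2} {l \<in> Ls. pt \<notin> l}"
proof -
  let ?R = "{l \<in> Ls. pt \<in> l}" and ?K = "{l \<in> Ls. pt \<notin> l}"
  have "finite ?R" "finite ?K" using finLs by auto
  then obtain e h where e: "bij_betw e {..<n + 1} ?R" and h: "bij_betw h {..<n\<^sup>2} ?K"
    using ex_bij_betw_nat_finite[of ?R] ex_bij_betw_nat_finite[of ?K]
    unfolding card_pencil[OF pt] card_antipencil[OF pt] atLeast0LessThan by blast
  have bijF: "bij_betw (\<lambda>Q. F Q m) m ?R" if "m \<in> ?K" for m
  proof -
    have "(\<lambda>Q. F Q m) ` m = ?R"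
    proof (rule card_subset_eq)
      show "card ((\<lambda>Q. F Q m) ` m) = card ?R"
        using card_image[OF inj_line] that cardl card_pencil[OF pt] by simp
    qed (use finLs F that in auto)
    then show ?thesis using inj_line that by (simp add: bij_betw_def)
  qed
  define A where "A i j = inv_into (h j) (\<lambda>Q. F Q (h j)) (e i)" for i j
  have ei: "e i \<in> ?R" if "i < n + 1" for i using bij_betwE[OF e] that by blast
  have hj: "h j \<in> ?K" if "j < n\<^sup>2" for j using bij_betwE[OF h] that by blast
  have A: "A i j \<in> h j" "F (A i j) (h j) = e i" if "i < n + 1" "j < n\<^sup>2" for i j
  proof -
    have "e i \<in> (\<lambda>Q. F Q (h j)) ` h j"
      using bijF[OF hj[OF that(2)]] ei[OF that(1)] by (simp add: bij_betw_def)
    then show "A i j \<in> h j" "F (A i j) (h j) = e i"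
      unfolding A_def by (fact inv_into_into, fact f_inv_into_f)
  qed
  have einj: "e i = e i' \<Longrightarrow> i < n + 1 \<Longrightarrow> i' < n + 1 \<Longrightarrow> i = i'" for i i'
    using inj_onD[OF bij_betw_imp_inj_on[OF e]] by simp
  have hinj: "h i = h i' \<Longrightarrow> i < n\<^sup>2 \<Longrightarrow> i' < n\<^sup>2 \<Longrightarrow> i = i'" for i i'
    using inj_onD[OF bij_betw_imp_inj_on[OF h]] by simp
  have rinj: "inj_on (\<lambda>j. A i j) {..<n\<^sup>2}" if "i < n + 1" for i
  proof (rule inj_onI)
    fix j j' assume "j \<in> {..<n\<^sup>2}" "j' \<in> {..<n\<^sup>2}" and eq: "A i j = A i j'"
    then have j: "j < n\<^sup>2" "j' < n\<^sup>2" by auto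
    have "h j = h j'"
      using inj_onD[OF inj_point, of "A i j" "h j" "h j'"] A[OF that j(1)] A[OF that j(2)]
        eq hj[OF j(1)] hj[OF j(2)] by simp
    then show "j = j'" using hinj j by blast
  qed
  have cinj: "inj_on (\<lambda>i. A i j) {..<n + 1}" if "j < n\<^sup>2" for j
  proof (rule inj_onI)
    fix i i' assume "i \<in> {..<n + 1}" "i' \<in> {..<n + 1}" and eq: "A i j = A i' j"
    then have i: "i < n + 1" "i' < n + 1" by auto
    have "e i = e i'" using A(2)[OF i(1) that] A(2)[OF i(2) that] eq by simp
    then show "i = i'" using einj i by blast
  qed
  have row: "row_symbols (n\<^sup>2) A i = P - e i" if "i < n + 1" for i
  proof (rule card_subset_eq)
    have "row_symbols (n\<^sup>2) A i = (\<lambda>j. A i j) ` {..<n\<^sup>2}"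
      unfolding row_symbols_def by auto
    then have "card (row_symbols (n\<^sup>2) A i) = n\<^sup>2"
      using card_image[OF rinj[OF that]] by simp
    moreover have "card (P - e i) = n\<^sup>2"
      using ei[OF that] subP finl cardl cardP by (simp add: card_Diff_subset)
    ultimately show "card (row_symbols (n\<^sup>2) A i) = card (P - e i)" by simp
    show "row_symbols (n\<^sup>2) A i \<subseteq> P - e i"
    proof
      fix s assume "s \<in> row_symbols (n\<^sup>2) A i"
      then obtain j where j: "j < n\<^sup>2" "s = A i j" unfolding row_symbols_def by blast
      have "s \<notin> e i" using A[OF that j(1)] F[of "h j" s] hj[OF j(1)] j(2) by auto
      moreover have "s \<in> P" using A(1)[OF that j(1)] hj[OF j(1)] j(2) subP by auto
      ultimately show "s \<in> P - e i" by blast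
    qed
  qed (use finP in simp)
  have col: "col_symbols (n + 1) A j = h j" if "j < n\<^sup>2" for j
  proof (rule card_subset_eq)
    have "col_symbols (n + 1) A j = (\<lambda>i. A i j) ` {..<n + 1}"
      unfolding col_symbols_def by auto
    then show "card (col_symbols (n + 1) A j) = card (h j)"
      using card_image[OF cinj[OF that]] cardl hj[OF that] by simp
    show "col_symbols (n + 1) A j \<subseteq> h j"
      unfolding col_symbols_def using A(1)[OF _ that] by blast
    show "finite (h j)" using hj[OF that] finl by simp
  qed
  have bcol: "bij_betw (col_symbols (n + 1) A) {..<n\<^sup>2} ?K"
    using h col by (subst bij_betw_cong[where g = h]) auto
  have "inj_on (\<lambda>l. P - l) ?R"
    by (rule inj_onI) (use subP in blast)
  then have "bij_betw (\<lambda>l. P - l) ?R {P - l | l. l \<in> Ls \<and> pt \<in> l}"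
    unfolding bij_betw_def by auto
  from bij_betw_trans[OF e this]
  have brow: "bij_betw (row_symbols (n\<^sup>2) A) {..<n + 1} {P - l | l. l \<in> Ls \<and> pt \<in> l}"
    using row by (subst bij_betw_cong[where g = "(\<lambda>l. P - l) \<circ> e"]) auto
  \<comment> \<open>The rows containing \<open>s\<close> are those whose pencil line avoids
    \<open>s\<close>, so this number is the replication number.\<close>
  have pencil_avoid: "card {l \<in> ?R. s \<notin> l} = n" if s: "s \<in> P - {pt}" for s
  proof -
    obtain k where k: "k \<in> Ls" "pt \<in> k" "s \<in> k" using ex_line[OF pt, of s] s by blast
    have "{l \<in> ?R. s \<notin> l} = ?R - {k}" using k s line_unique[OF k(1)] by blast
    then show ?thesis using k card_pencil[OF pt] finLs by simp
  qed
  have sym: "symbols (n + 1) (n\<^sup>2) A = P - {pt}"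
  proof -
    have "symbols (n + 1) (n\<^sup>2) A = (\<Union>i<n + 1. row_symbols (n\<^sup>2) A i)"
      unfolding symbols_def row_symbols_def by auto
    also have "\<dots> = (\<Union>i<n + 1. P - e i)" using row by auto
    also have "\<dots> = (\<Union>l\<in>?R. P - l)" using e by (auto simp: bij_betw_def)
    also have "\<dots> = P - {pt}"
    proof -
      have "\<exists>l\<in>?R. s \<notin> l" if "s \<in> P - {pt}" for s
      proof -
        have "{l \<in> ?R. s \<notin> l} \<noteq> {}" using pencil_avoid[OF that] n2 by (metis card.empty not_numeral_le_zero)
        then show ?thesis by blast
      qed
      then show ?thesis by blast
    qed
    finally show ?thesis .
  qed
  have csym: "card (symbols (n + 1) (n\<^sup>2) A) = n * (n + 1)"
    using sym pt finP cardP by (simp add: power2_eq_square)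
  have rep: "card {(i, j). i < n + 1 \<and> j < n\<^sup>2 \<and> A i j = s} = n" if "s \<in> P - {pt}" for s
  proof -
    let ?S = "{(i, j). i < n + 1 \<and> j < n\<^sup>2 \<and> A i j = s}"
    have "bij_betw (e \<circ> fst) ?S {l \<in> ?R. s \<notin> l}"
      unfolding bij_betw_def
    proof
      show "inj_on (e \<circ> fst) ?S"
      proof (rule inj_onI)
        fix u w assume uw: "u \<in> ?S" "w \<in> ?S" "(e \<circ> fst) u = (e \<circ> fst) w"
        obtain i j i' j' where ij: "u = (i, j)" "w = (i', j')" by fastforce
        have "i = i'" using uw einj unfolding ij by simp
        moreover have "j = j'"
          using inj_onD[OF rinj, of i j j'] uw \<open>i = i'\<close> unfolding ij by simp
        ultimately show "u = w" unfolding ij by simp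
      qed
      show "(e \<circ> fst) ` ?S = {l \<in> ?R. s \<notin> l}"
      proof (intro equalityI subsetI)
        fix l assume "l \<in> (e \<circ> fst) ` ?S"
        then obtain i j where ij: "i < n + 1" "j < n\<^sup>2" "A i j = s" "l = e i" by auto
        then have "s \<in> row_symbols (n\<^sup>2) A i" unfolding row_symbols_def by blast
        then show "l \<in> {l \<in> ?R. s \<notin> l}" using ij ei row by auto
      next
        fix l assume l: "l \<in> {l \<in> ?R. s \<notin> l}"
        then obtain i where i: "i < n + 1" "l = e i"
          using e unfolding bij_betw_def by blast
        then have "s \<in> row_symbols (n\<^sup>2) A i" using row that l by auto
        then obtain j where "j < n\<^sup>2" "A i j = s" unfolding row_symbols_def by blast
        then have "(i, j) \<in> ?S" "l = (e \<circ> fst) (i, j)" using i by auto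
        then show "l \<in> (e \<circ> fst) ` ?S" by blast
      qed
    qed
    from bij_betw_same_card[OF this] show ?thesis using pencil_avoid[OF that] by simp
  qed
  have int1: "card (l \<inter> m) = 1" if lm: "l \<in> Ls" "m \<in> Ls" "l \<noteq> m" for l m
  proof -
    have "l \<inter> m = {meet l m}" using lm meet_in line_unique by blast
    then show ?thesis by simp
  qed
  have RR: "card (row_symbols (n\<^sup>2) A i \<inter> row_symbols (n\<^sup>2) A i') = n\<^sup>2 - n"
    if "i < n + 1" "i' < n + 1" "i \<noteq> i'" for i i'
  proof -
    have l: "e i \<in> Ls" "e i' \<in> Ls" "e i \<noteq> e i'" using that ei einj by auto
    have "card (e i \<union> e i') + card (e i \<inter> e i') = 2 * (n + 1)"
      using card_Un_Int[OF finl[OF l(1)] finl[OF l(2)]] cardl l by simp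
    then have u: "card (e i \<union> e i') = 2 * n + 1" using int1[OF l] by simp
    have "row_symbols (n\<^sup>2) A i \<inter> row_symbols (n\<^sup>2) A i' = P - (e i \<union> e i')"
      using row that by auto
    moreover have "card (P - (e i \<union> e i')) = card P - card (e i \<union> e i')"
      using l subP finl by (intro card_Diff_subset) auto
    ultimately show ?thesis using u cardP by simp
  qed
  have CC: "card (col_symbols (n + 1) A j \<inter> col_symbols (n + 1) A j') = 1"
    if "j < n\<^sup>2" "j' < n\<^sup>2" "j \<noteq> j'" for j j'
    using col[OF that(1)] col[OF that(2)] int1[of "h j" "h j'"]
      hj[OF that(1)] hj[OF that(2)] hinj[OF _ that(1,2)] that(3) by auto
  have RC: "card (row_symbols (n\<^sup>2) A i \<inter> col_symbols (n + 1) A j) = n"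
    if "i < n + 1" "j < n\<^sup>2" for i j
  proof -
    have l: "e i \<in> Ls" "h j \<in> Ls" "h j \<noteq> e i" using that ei[of i] hj[of j] by auto
    have "row_symbols (n\<^sup>2) A i \<inter> col_symbols (n + 1) A j = h j - (h j \<inter> e i)"
      using row col that subP[OF l(2)] by auto
    moreover have "card (h j - (h j \<inter> e i)) = card (h j) - card (h j \<inter> e i)"
      using l finl by (intro card_Diff_subset) auto
    ultimately show ?thesis using int1[OF l(2,1,3)] cardl[OF l(2)] by simp
  qed
  have "triple_array (n + 1) (n\<^sup>2) (n * (n + 1)) A"
    unfolding triple_array_def
  proof (intro conjI)
    show "n + 1 \<ge> 2" "n * (n + 1) \<ge> 1" using n2 by auto
    have "2 * 2 \<le> n * n" using n2 by (intro mult_mono) auto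
    then show "n\<^sup>2 \<ge> 2" by (simp add: power2_eq_square)
    show "binary_array (n + 1) (n\<^sup>2) A" unfolding binary_array_def using rinj cinj by blast
    show "equireplicate (n + 1) (n\<^sup>2) A"
      unfolding equireplicate_def using csym rep sym
      by (intro exI[of _ n]) (auto simp: power2_eq_square algebra_simps)
  qed (use csym RR CC RC in blast)+
  moreover have "n * (n + 1) = n + 1 + n\<^sup>2 - 1" by (simp add: power2_eq_square)
  ultimately show ?thesis
    using sym brow bcol unfolding extremal_triple_array_def by blast
qed

end

text \<open>The cyclic shift of an enumeration moves every element as soon as there are two.\<close>

lemma ex_derangement:
  assumes "finite I" "card I \<ge> 2"
  shows "\<exists>d. d ` I \<subseteq> I \<and> inj_on d I \<and> (\<forall>i\<in>I. d i \<noteq> i)"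
proof -
  let ?k = "card I"
  obtain h where h: "bij_betw h I {0..<?k}"
    using ex_bij_betw_finite_nat[OF assms(1)] by blast
  define s where "s i = (if Suc i = ?k then 0 else Suc i)" for i
  define d where "d = inv_into I h \<circ> s \<circ> h"
  have s: "inj_on s {0..<?k}" "s ` {0..<?k} \<subseteq> {0..<?k}" "\<And>i. s i \<noteq> i"
    using assms(2) by (auto simp: inj_on_def s_def)
  have hd: "h (d i) = s (h i)" "d i \<in> I" if "i \<in> I" for i
  proof -
    have "s (h i) \<in> h ` I" using s(2) that bij_betw_imp_surj_on[OF h] by blast
    then show "h (d i) = s (h i)" "d i \<in> I"
      by (auto simp: d_def f_inv_into_f inv_into_into)
  qed
  have "inj_on d I"
  proof (rule inj_onI)
    fix i j assume ij: "i \<in> I" "j \<in> I" "d i = d j"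
    then have "s (h i) = s (h j)" using hd(1) by metis
    moreover have "h i \<in> {0..<?k}" "h j \<in> {0..<?k}" using ij bij_betwE[OF h] by auto
    ultimately have "h i = h j" using inj_onD[OF s(1)] by blast
    then show "i = j" using inj_onD[OF bij_betw_imp_inj_on[OF h]] ij by blast
  qed
  moreover have "d i \<noteq> i" if "i \<in> I" for i using hd(1)[OF that] s(3)[of "h i"] by auto
  ultimately show ?thesis using hd(2) by blast
qed

section \<open>Tangents of an oval in odd order\<close>

locale oval_plane = proj_plane +
  fixes C :: "'a set" and pt :: 'a
  assumes odd_n: "odd n" and subC: "C \<subseteq> P" and cardC: "card C = n + 1" and ptC: "pt \<in> C"
    and no_three: "\<lbrakk>l \<in> Ls; x \<in> C; y \<in> C; z \<in> C; x \<in> l; y \<in> l; z \<in> l\<rbrakk>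
      \<Longrightarrow> x = y \<or> x = z \<or> y = z"
begin

lemma finC: "finite C"
  using finP subC finite_subset by blast

text \<open>The joins of \<open>x\<close> to the \<open>n\<close> other oval points cover at most
  \<open>n\<close> of the \<open>n + 1\<close> lines through \<open>x\<close>.\<close>

lemma ex_tangent:
  assumes x: "x \<in> C" shows "\<exists>l\<in>Ls. l \<inter> C = {x}"
proof -
  define j where "j y = (SOME l. l \<in> Ls \<and> x \<in> l \<and> y \<in> l)" for y
  have j: "j y \<in> Ls \<and> x \<in> j y \<and> y \<in> j y" if "y \<in> C - {x}" for y
  proof -
    have "\<exists>l. l \<in> Ls \<and> x \<in> l \<and> y \<in> l" using ex_line[of x y] x that subC by blast
    then show ?thesis unfolding j_def by (rule someI_ex)
  qed
  have "card (j ` (C - {x})) \<le> card (C - {x})"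
    using finC by (intro card_image_le) simp
  also have "\<dots> < card {l \<in> Ls. x \<in> l}"
    using card_pencil[of x] x subC finC cardC by auto
  finally have "\<not> {l \<in> Ls. x \<in> l} \<subseteq> j ` (C - {x})"
    using finC by (meson card_mono finite_Diff finite_imageI not_less)
  then obtain l where l: "l \<in> Ls" "x \<in> l" "l \<notin> j ` (C - {x})" by blast
  have "y = x" if y: "y \<in> l" "y \<in> C" for y
  proof (rule ccontr)
    assume "y \<noteq> x"
    then have "l = j y" using j[of y] line_unique[OF l(1), of "j y" x y] l(2) y by blast
    then show False using l(3) y \<open>y \<noteq> x\<close> by blast
  qed
  then show ?thesis using l x by blast
qed

definition tangent :: "'a \<Rightarrow> 'a set" where
  "tangent x = (SOME l. l \<in> Ls \<and> l \<inter> C = {x})"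

lemma tangent:
  assumes "x \<in> C" shows "tangent x \<in> Ls" "tangent x \<inter> C = {x}"
proof -
  have "\<exists>l. l \<in> Ls \<and> l \<inter> C = {x}" using ex_tangent[OF assms] by blast
  then have "tangent x \<in> Ls \<and> tangent x \<inter> C = {x}"
    unfolding tangent_def by (rule someI_ex)
  then show "tangent x \<in> Ls" "tangent x \<inter> C = {x}" by auto
qed

lemma in_tangent: "x \<in> C \<Longrightarrow> x \<in> tangent x"
  using tangent(2) by blast

lemma tangent_oval: "x \<in> C \<Longrightarrow> y \<in> C \<Longrightarrow> y \<in> tangent x \<Longrightarrow> y = x"
  using tangent(2) by blast

lemma tangent_meet_unique:
  assumes "x \<in> C" "y \<in> C" "x \<noteq> y" "p \<in> tangent x" "p \<in> tangent y" "q \<in> tangent x" "q \<in> tangent y"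
  shows "p = q"
  using assms tangent line_unique[of "tangent x" "tangent y" p q] by blast

text \<open>The joins of \<open>a\<close> to the other oval points are \<open>n\<close> different
  secants, so the pencil of \<open>n + 1\<close> lines at \<open>a\<close> has no room for two
  tangents.\<close>

lemma tangent_eqI:
  assumes l: "l \<in> Ls" and a: "l \<inter> C = {a}"
  shows "l = tangent a"
proof -
  have aC: "a \<in> C" "a \<in> l" using a by auto
  show ?thesis
  proof (rule ccontr)
    assume ne: "l \<noteq> tangent a"
    define j where "j y = (SOME l. l \<in> Ls \<and> a \<in> l \<and> y \<in> l)" for y
    have j: "j y \<in> Ls \<and> a \<in> j y \<and> y \<in> j y" if "y \<in> C - {a}" for y
    proof -
      have "\<exists>l. l \<in> Ls \<and> a \<in> l \<and> y \<in> l" using ex_line[of a y] aC that subC by blast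
      then show ?thesis unfolding j_def by (rule someI_ex)
    qed
    have "inj_on j (C - {a})"
    proof (rule inj_onI)
      fix y z assume yz: "y \<in> C - {a}" "z \<in> C - {a}" "j y = j z"
      then show "y = z" using no_three[of "j y" a y z] j[of y] j[of z] aC(1) by auto
    qed
    then have "card (j ` (C - {a})) = n" using card_image finC cardC aC by fastforce
    moreover have "j ` (C - {a}) \<subseteq> {l \<in> Ls. a \<in> l} - {l, tangent a}"
      using j a tangent_oval[OF aC(1)] by auto
    then have "card (j ` (C - {a})) \<le> card ({l \<in> Ls. a \<in> l} - {l, tangent a})"
      using finLs by (intro card_mono) auto
    moreover have "card ({k \<in> Ls. a \<in> k} - {l, tangent a}) = n + 1 - 2"
      using ne aC l tangent[OF aC(1)] in_tangent[OF aC(1)] card_pencil[of a] subC finLs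
      by (subst card_Diff_subset) auto
    ultimately show False using n2 by simp
  qed
qed

text \<open>The remaining \<open>n\<close> points of the oval cannot all be paired off by the secants
  through \<open>Q\<close>, because \<open>n\<close> is odd.\<close>

lemma ex_other_tangent:
  assumes a: "a \<in> C" and Q: "Q \<in> tangent a" "Q \<noteq> a"
  shows "\<exists>c\<in>C. c \<noteq> a \<and> Q \<in> tangent c"
proof (rule ccontr)
  assume none: "\<not> (\<exists>c\<in>C. c \<noteq> a \<and> Q \<in> tangent c)"
  have QP: "Q \<in> P" "Q \<notin> C"
    using subP[OF tangent(1)[OF a]] Q tangent_oval[OF a] by auto
  let ?S = "{l \<in> Ls. Q \<in> l} - {tangent a}"
  have eq: "C - {a} = (\<Union>l\<in>?S. l \<inter> C)"
  proof (intro equalityI subsetI)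
    fix y assume y: "y \<in> C - {a}"
    then obtain l where "l \<in> Ls" "Q \<in> l" "y \<in> l" using ex_line[of Q y] QP subC by blast
    moreover have "y \<notin> tangent a" using y tangent_oval[OF a] by blast
    ultimately show "y \<in> (\<Union>l\<in>?S. l \<inter> C)" using y by blast
  next
    fix y assume "y \<in> (\<Union>l\<in>?S. l \<inter> C)"
    then obtain l where l: "l \<in> Ls" "Q \<in> l" "l \<noteq> tangent a" "y \<in> l" "y \<in> C" by blast
    have "y \<noteq> a"
      using line_unique[OF l(1) tangent(1)[OF a] Q(2) l(2)] Q(1) l in_tangent[OF a] by blast
    then show "y \<in> C - {a}" using l by blast
  qed
  have "card (C - {a}) = (\<Sum>l\<in>?S. card (l \<inter> C))"
    unfolding eq
  proof (rule card_UN_disjoint)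
    show "\<forall>l\<in>?S. \<forall>m\<in>?S. l \<noteq> m \<longrightarrow> (l \<inter> C) \<inter> (m \<inter> C) = {}"
    proof (intro ballI impI)
      fix l m assume lm: "l \<in> ?S" "m \<in> ?S" "l \<noteq> m"
      have False if y: "y \<in> l" "y \<in> m" "y \<in> C" for y
        using line_unique[of l m Q y] lm y QP(2) by auto
      then show "(l \<inter> C) \<inter> (m \<inter> C) = {}" by blast
    qed
  qed (use finLs finC in auto)
  moreover have "even (\<Sum>l\<in>?S. card (l \<inter> C))"
  proof (rule dvd_sum)
    fix l assume l: "l \<in> ?S"
    show "even (card (l \<inter> C))"
    proof (cases "\<exists>y. y \<in> l \<inter> C")
      case True
      then obtain y where y: "y \<in> l" "y \<in> C" by blast
      \<comment> \<open>Otherwise \<open>l\<close> would be the tangent at \<open>y\<close>: for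
        \<open>y = a\<close> that line was removed from the sum, for other \<open>y\<close> it
        contradicts \<open>none\<close>.\<close>
      have "l \<inter> C \<noteq> {y}"
        using tangent_eqI[of l y] l none y(2) by auto
      then obtain z where z: "z \<in> l" "z \<in> C" "z \<noteq> y" using y by blast
      have "l \<inter> C = {y, z}" using no_three[of l] l y z by blast
      then show ?thesis using z(3) by simp
    next
      case False
      then have "l \<inter> C = {}" by blast
      then show ?thesis by simp
    qed
  qed
  ultimately show False using odd_n a cardC finC by simp
qed

text \<open>Choosing a second tangent at each of the \<open>n\<close> points of
  \<open>tangent a\<close> other than \<open>a\<close> gives an injection into the \<open>n\<close>
  points of \<open>C - {a}\<close>, because two tangents meet only once. So the choice is a
  bijection: every tangent is used up at its own meet with \<open>tangent a\<close>, and none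
  remains as a third one through \<open>Q\<close>.\<close>

lemma other_tangent_unique:
  assumes abc: "a \<in> C" "b \<in> C" "c \<in> C" "a \<noteq> b" "a \<noteq> c"
    and Q: "Q \<in> tangent a" "Q \<in> tangent b" "Q \<in> tangent c"
  shows "b = c"
proof -
  define t where "t Q = (SOME c. c \<in> C - {a} \<and> Q \<in> tangent c)" for Q
  have t: "t Q \<in> C - {a} \<and> Q \<in> tangent (t Q)" if "Q \<in> tangent a - {a}" for Q
  proof -
    have "\<exists>c. c \<in> C - {a} \<and> Q \<in> tangent c" using ex_other_tangent[OF abc(1)] that by blast
    then show ?thesis unfolding t_def by (rule someI_ex)
  qed
  have "inj_on t (tangent a - {a})"
  proof (rule inj_onI)
    fix p q assume "p \<in> tangent a - {a}" "q \<in> tangent a - {a}" "t p = t q"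
    then show "p = q" using tangent_meet_unique[OF abc(1), of "t p" p q] t[of p] t[of q] by auto
  qed
  then have "card (t ` (tangent a - {a})) = card (C - {a})"
    using card_image[of t] cardl[OF tangent(1)[OF abc(1)]] cardC finC abc(1) in_tangent[OF abc(1)]
      finl[OF tangent(1)[OF abc(1)]] by simp
  then have surj: "t ` (tangent a - {a}) = C - {a}"
    using t finC by (intro card_subset_eq) auto
  have "t Q = d" if d: "d \<in> C" "d \<noteq> a" "Q \<in> tangent d" for d
  proof -
    obtain q where q: "q \<in> tangent a - {a}" "d = t q" using surj d by blast
    then have "q = Q" using tangent_meet_unique[OF abc(1) d(1), of q Q] t[of q] d Q(1) by auto
    then show ?thesis using q by simp
  qed
  then show ?thesis using abc Q by metis
qed

text \<open>No second tangent passes through the contact point \<open>a\<close>; there the value is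
  \<open>a\<close> itself, which keeps \<open>other a\<close> injective on the whole
  tangent.\<close>

definition other :: "'a \<Rightarrow> 'a \<Rightarrow> 'a" where
  "other a R = (SOME c. c \<in> C \<and> R \<in> tangent c \<and> (c = a \<longleftrightarrow> R = a))"

lemma other:
  assumes "a \<in> C" "R \<in> tangent a"
  shows "other a R \<in> C" "R \<in> tangent (other a R)" "other a R = a \<longleftrightarrow> R = a"
proof -
  have "\<exists>c. c \<in> C \<and> R \<in> tangent c \<and> (c = a \<longleftrightarrow> R = a)"
    using ex_other_tangent[OF assms] assms by (cases "R = a") auto
  then have "other a R \<in> C \<and> R \<in> tangent (other a R) \<and> (other a R = a \<longleftrightarrow> R = a)"
    unfolding other_def by (rule someI_ex)
  then show "other a R \<in> C" "R \<in> tangent (other a R)" "other a R = a \<longleftrightarrow> R = a" by auto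
qed

lemma other_inj:
  assumes "a \<in> C" "R \<in> tangent a" "R' \<in> tangent a" "other a R = other a R'"
  shows "R = R'"
  using assms other[of a R] other[of a R'] tangent_meet_unique[of a "other a R" R R'] by metis

section \<open>Indexing the pencil of \<open>pt\<close> by the oval\<close>

definition pencil_line :: "'a \<Rightarrow> 'a set" where
  "pencil_line c = (if c = pt then tangent pt else SOME l. l \<in> Ls \<and> pt \<in> l \<and> c \<in> l)"

lemma pencil_line:
  assumes "c \<in> C"
  shows "pencil_line c \<in> Ls" "pt \<in> pencil_line c" "c \<in> pencil_line c"
proof -
  have "pencil_line c \<in> Ls \<and> pt \<in> pencil_line c \<and> c \<in> pencil_line c"
  proof (cases "c = pt")
    case True
    then show ?thesis using tangent(1)[OF ptC] in_tangent[OF ptC] by (simp add: pencil_line_def)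
  next
    case False
    have "\<exists>l. l \<in> Ls \<and> pt \<in> l \<and> c \<in> l" using ex_line[of pt c] False assms ptC subC by blast
    then have "(SOME l. l \<in> Ls \<and> pt \<in> l \<and> c \<in> l) \<in> Ls \<and> pt \<in> (SOME l. l \<in> Ls \<and> pt \<in> l \<and> c \<in> l)
        \<and> c \<in> (SOME l. l \<in> Ls \<and> pt \<in> l \<and> c \<in> l)"
      by (rule someI_ex)
    then show ?thesis using False by (simp add: pencil_line_def)
  qed
  then show "pencil_line c \<in> Ls" "pt \<in> pencil_line c" "c \<in> pencil_line c" by auto
qed

text \<open>Sharing \<open>Q\<close> and \<open>pt\<close> makes the two lines equal. A line through
  \<open>pt\<close> has at most one further oval point, and the tangent at \<open>pt\<close> has
  none.\<close>

lemma pencil_line_inj: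
  assumes c: "c \<in> C" and d: "d \<in> C" and Q: "Q \<noteq> pt" "Q \<in> pencil_line c" "Q \<in> pencil_line d"
  shows "c = d"
proof -
  have eq: "pencil_line c = pencil_line d"
    using line_unique[of "pencil_line c" "pencil_line d" Q pt] pencil_line[OF c] pencil_line[OF d] Q
    by blast
  have mem: "c \<in> pencil_line d" "d \<in> pencil_line c"
    using eq pencil_line(3)[OF c] pencil_line(3)[OF d] by auto
  show ?thesis
  proof (cases "c = pt \<or> d = pt")
    case True
    then show ?thesis
      using mem tangent_oval[OF ptC c] tangent_oval[OF ptC d] by (auto simp: pencil_line_def)
  next
    case False
    then show ?thesis
      using no_three[OF pencil_line(1)[OF c] ptC c d pencil_line(2,3)[OF c] mem(2)] by auto
  qed
qed

text \<open>This is the one index that the colour of a flag at \<open>Q\<close> must avoid.\<close>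

definition pencil_index :: "'a \<Rightarrow> 'a" where
  "pencil_index Q = (SOME c. c \<in> C \<and> Q \<in> pencil_line c)"

lemma pencil_index:
  assumes "Q \<in> P" "Q \<noteq> pt"
  shows "pencil_index Q \<in> C" "Q \<in> pencil_line (pencil_index Q)"
proof -
  obtain l where l: "l \<in> Ls" "pt \<in> l" "Q \<in> l" using ex_line[of pt Q] assms ptC subC by blast
  have "\<exists>c. c \<in> C \<and> Q \<in> pencil_line c"
  proof (cases "l \<inter> C = {pt}")
    case True
    then have "l = pencil_line pt" using tangent_eqI[OF l(1)] by (simp add: pencil_line_def)
    then show ?thesis using l ptC by blast
  next
    case False
    then obtain c where c: "c \<in> l" "c \<in> C" "c \<noteq> pt" using l ptC by blast
    then have "l = pencil_line c"
      using line_unique[OF l(1) pencil_line(1)[OF c(2)], of c pt] pencil_line[OF c(2)] l by blast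
    then show ?thesis using l c by blast
  qed
  then have "pencil_index Q \<in> C \<and> Q \<in> pencil_line (pencil_index Q)"
    unfolding pencil_index_def by (rule someI_ex)
  then show "pencil_index Q \<in> C" "Q \<in> pencil_line (pencil_index Q)" by auto
qed

lemma pencil_index_eq:
  "\<lbrakk>Q \<in> P; Q \<noteq> pt; c \<in> C; Q \<in> pencil_line c\<rbrakk> \<Longrightarrow> pencil_index Q = c"
  using pencil_index pencil_line_inj by blast

section \<open>The basic colour and its injectivity\<close>

text \<open>The tangents at \<open>a\<close> and at \<open>third x a\<close> meet here; for a conic
  this is the pole of the chord joining their contact points.\<close>

definition pole :: "'a \<Rightarrow> 'a \<Rightarrow> 'a" where
  "pole x a = meet (pencil_line x) (tangent a)"

text \<open>For fixed \<open>x\<close> other than \<open>pt\<close> this is a fixed-point-free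
  involution of \<open>C - {pt, x}\<close>: it pairs the oval points whose tangents meet on
  \<open>pencil_line x\<close>.\<close>

definition third :: "'a \<Rightarrow> 'a \<Rightarrow> 'a" where
  "third x a = other a (pole x a)"

lemma pole:
  assumes "x \<in> C" "a \<in> C"
  shows "pole x a \<in> pencil_line x" "pole x a \<in> tangent a"
  using meet_in pencil_line(1) tangent(1) assms unfolding pole_def by auto

lemma pole_eqI:
  assumes x: "x \<in> C" and a: "a \<in> C" "a \<noteq> pt" and Q: "Q \<in> pencil_line x" "Q \<in> tangent a"
  shows "Q = pole x a"
proof (rule ccontr)
  assume "Q \<noteq> pole x a"
  then have "pencil_line x = tangent a"
    using line_unique[OF pencil_line(1)[OF x] tangent(1)[OF a(1)]] pole[OF x a(1)] Q by blast
  then show False using pencil_line(2)[OF x] tangent_oval[OF a(1) ptC] a(2) by auto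
qed

lemma pole_neq_pt:
  "x \<in> C \<Longrightarrow> a \<in> C \<Longrightarrow> a \<noteq> pt \<Longrightarrow> pole x a \<noteq> pt"
  using pole(2) tangent_oval ptC by metis

text \<open>The value \<open>a\<close> would place the pole at \<open>a\<close>, hence on
  \<open>pencil_line a\<close>; the value \<open>pt\<close> would place it on
  \<open>pencil_line pt\<close>; and the value \<open>x\<close> would place it at \<open>x\<close>,
  an oval point off \<open>tangent a\<close>.\<close>

lemma third:
  assumes x: "x \<in> C" "x \<noteq> pt" and a: "a \<in> C" "a \<noteq> pt" and ne: "x \<noteq> a"
  shows "third x a \<in> C" "third x a \<noteq> pt" "third x a \<noteq> a" "third x a \<noteq> x"
    "pole x a \<in> tangent (third x a)"
proof -
  note R = pole[OF x(1) a(1)] and o = other[OF a(1) pole(2)[OF x(1) a(1)]]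
    and npt = pole_neq_pt[OF x(1) a]
  show C3: "third x a \<in> C" and R3: "pole x a \<in> tangent (third x a)"
    unfolding third_def using o by auto
  show "third x a \<noteq> a"
    unfolding third_def o(3)
    using pencil_line_inj[OF x(1) a(1) npt R(1)] pencil_line(3)[OF a(1)] ne by metis
  show "third x a \<noteq> pt"
  proof
    assume "third x a = pt"
    then have "pole x a \<in> pencil_line pt" using R3 by (simp add: pencil_line_def)
    then show False using pencil_line_inj[OF x(1) ptC npt R(1)] x(2) by simp
  qed
  show "third x a \<noteq> x"
  proof
    assume "third x a = x"
    then have "pole x a = x"
      using R3 R pole_eqI[OF x(1) x, of "pole x a"] pole_eqI[OF x(1) x, of x]
        pencil_line(3)[OF x(1)] in_tangent[OF x(1)] by simp
    then show False using R(2) tangent_oval[OF a(1) x(1)] ne by simp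
  qed
qed

text \<open>Separates the points of one line, where the class \<open>a\<close> is fixed.\<close>

lemma third_inj_left:
  assumes x: "x \<in> C" and y: "y \<in> C" and a: "a \<in> C" "a \<noteq> pt" and eq: "third x a = third y a"
  shows "x = y"
proof -
  have "pole x a = pole y a"
    using other_inj[OF a(1) pole(2)[OF x a(1)] pole(2)[OF y a(1)]] eq by (simp add: third_def)
  then show ?thesis
    using pencil_line_inj[OF x y pole_neq_pt[OF x a]] pole(1)[OF x a(1)] pole(1)[OF y a(1)] by simp
qed

text \<open>Separates the lines through one point, where \<open>x\<close> is fixed. The common value
  \<open>c\<close> determines the pole as the meet of \<open>pencil_line x\<close> and
  \<open>tangent c\<close>, and only one further tangent passes through it.\<close>

lemma third_inj_right:
  assumes x: "x \<in> C" "x \<noteq> pt" and a: "a \<in> C" "a \<noteq> pt" "x \<noteq> a" and b: "b \<in> C" "b \<noteq> pt" "x \<noteq> b"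
    and eq: "third x a = third x b"
  shows "a = b"
proof -
  note A = third[OF x a] and B = third[OF x b]
  have "pole x a = pole x b"
    using pole_eqI[OF x(1) A(1,2) pole(1)[OF x(1) a(1)] A(5)]
      pole_eqI[OF x(1) B(1,2) pole(1)[OF x(1) b(1)] B(5)] eq by simp
  then show ?thesis
    using other_tangent_unique[of "third x a" a b "pole x a"] A B eq a b
      pole(2)[OF x(1) a(1)] pole(2)[OF x(1) b(1)] by metis
qed

text \<open>Both \<open>Q\<close> and the pole are the meet of \<open>pencil_line x\<close> with
  \<open>tangent (third x a)\<close>, so they agree. This keeps a basic colour at \<open>Q\<close>
  from coinciding with a class whose tangent passes through \<open>Q\<close>.\<close>

lemma third_tangentD:
  assumes x: "x \<in> C" "x \<noteq> pt" and a: "a \<in> C" "a \<noteq> pt" "x \<noteq> a"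
    and Q: "Q \<in> pencil_line x" "Q \<in> tangent (third x a)"
  shows "Q \<in> tangent a"
  using pole_eqI[OF x(1) third(1,2)[OF x a] Q] pole(2)[OF x(1) a(1)]
    pole_eqI[OF x(1) third(1,2)[OF x a] pole(1)[OF x(1) a(1)] third(5)[OF x a]] by simp

section \<open>The colouring of the flags\<close>

text \<open>Fix a derangement \<open>d\<close> of \<open>C - {pt}\<close>. A line \<open>m\<close> not through \<open>pt\<close> meets the tangent at \<open>pt\<close>
  in a point lying on exactly one further tangent, at \<open>b\<close> say, and is given the class \<open>a = d b\<close>.
  As \<open>d\<close> has no fixed point, that point does not lie on the tangent at \<open>a\<close>. Hence a line through a
  point \<open>Q\<close> off the tangent at \<open>pt\<close> is determined by its class, and one through a point on that
  tangent by its intersection with the tangent at \<open>a\<close>.\<close>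

lemma ex_flag_index:
  "\<exists>f. (\<forall>m\<in>Ls. pt \<notin> m \<longrightarrow> inj_on (\<lambda>Q. f Q m) m) \<and>
     (\<forall>m\<in>Ls. pt \<notin> m \<longrightarrow> (\<forall>Q\<in>m. f Q m \<in> C \<and> f Q m \<noteq> pencil_index Q)) \<and>
     (\<forall>Q. inj_on (f Q) {m \<in> Ls. pt \<notin> m \<and> Q \<in> m})"
proof -
  let ?T = "tangent pt"
  let ?K = "{m \<in> Ls. pt \<notin> m}"
  have T: "?T \<in> Ls" "pt \<in> ?T" using tangent(1)[OF ptC] in_tangent[OF ptC] by auto
  define X where "X m = meet m ?T" for m
  define b where "b m = other pt (X m)" for m
  have X: "X m \<in> m" "X m \<in> ?T" "X m \<noteq> pt" if "m \<in> ?K" for m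
    using meet_in[of m ?T] that T(1) unfolding X_def by auto
  have X_eqI: "Q = X m" if "m \<in> ?K" "Q \<in> m" "Q \<in> ?T" for Q m
    using line_unique[of m ?T Q "X m"] X[OF that(1)] that T by blast
  have b: "b m \<in> C" "b m \<noteq> pt" "X m \<in> tangent (b m)" if "m \<in> ?K" for m
    using other[OF ptC X(2)[OF that]] X(3)[OF that] unfolding b_def by auto
  have b_inj: "X m = X m'" if "m \<in> ?K" "m' \<in> ?K" "b m = b m'" for m m'
    using other_inj[OF ptC X(2)[OF that(1)] X(2)[OF that(2)]] that(3) unfolding b_def by blast
  have "finite (C - {pt})" "card (C - {pt}) \<ge> 2" using finC cardC ptC n2 by auto
  then obtain d where d: "d ` (C - {pt}) \<subseteq> C - {pt}" "inj_on d (C - {pt})"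
      "\<And>i. i \<in> C - {pt} \<Longrightarrow> d i \<noteq> i"
    using ex_derangement[of "C - {pt}"] by metis
  define a where "a m = d (b m)" for m
  have a: "a m \<in> C" "a m \<noteq> pt" "a m \<noteq> b m" if "m \<in> ?K" for m
    using d(1) d(3)[of "b m"] b(1,2)[OF that] unfolding a_def by auto
  have a_inj: "X m = X m'" if "m \<in> ?K" "m' \<in> ?K" "a m = a m'" for m m'
  proof -
    have "b m = b m'"
      using inj_onD[OF d(2)] b(1,2)[OF that(1)] b(1,2)[OF that(2)] that(3) unfolding a_def by simp
    then show ?thesis using b_inj that(1,2) by blast
  qed
  have Xa: "X m \<notin> tangent (a m)" if m: "m \<in> ?K" for m
    using other_tangent_unique[OF ptC a(1)[OF m] b(1)[OF m] _ _ X(2)[OF m] _ b(3)[OF m]]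
      a(2,3)[OF m] b(2)[OF m] by metis
  define R where "R m = meet m (tangent (a m))" for m
  have R: "R m \<in> m" "R m \<in> tangent (a m)" if "m \<in> ?K" for m
    using meet_in[of m "tangent (a m)"] tangent(1)[OF a(1)[OF that]] that unfolding R_def by auto
  have R_eqI: "Q = R m" if m: "m \<in> ?K" and Q: "Q \<in> m" "Q \<in> tangent (a m)" for Q m
  proof -
    \<comment> \<open>The line \<open>m\<close> may itself be a tangent, but not the one at
      \<open>a m\<close>.\<close>
    have "m \<noteq> tangent (a m)" using Xa[OF m] X(1)[OF m] by metis
    then show ?thesis
      using line_unique[of m "tangent (a m)" Q "R m"] R[OF m] m Q tangent(1)[OF a(1)[OF m]] by blast
  qed
  \<comment> \<open>As \<open>R m\<close> equals \<open>pole (pencil_index (R m)) (a m)\<close>,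
    this is the basic colour of \<open>R m\<close>.\<close>
  define c where "c m = other (a m) (R m)" for m
  have c: "c m \<in> C" "c m \<noteq> pt" "c m = a m \<longleftrightarrow> R m = a m" if m: "m \<in> ?K" for m
  proof -
    note o = other[OF a(1)[OF m] R(2)[OF m]]
    show "c m \<in> C" "c m = a m \<longleftrightarrow> R m = a m" using o unfolding c_def by auto
    show "c m \<noteq> pt"
      using o(2) X_eqI[OF m R(1)[OF m]] R(2)[OF m] Xa[OF m] unfolding c_def by metis
  qed
  let ?x = pencil_index
  \<comment> \<open>The rotation: \<open>X m\<close> takes the basic colour of \<open>R m\<close>,
    \<open>R m\<close> takes \<open>a m\<close>, and the point with index \<open>a m\<close> takes
    \<open>pt\<close>. If \<open>R m\<close> is the contact point \<open>a m\<close>, the last two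
    points coincide, the second clause applies, and \<open>c m = a m\<close> leaves a mere
    exchange.\<close>
  define f where "f Q m = (if Q \<in> ?T then c m else if ?x Q = a m then pt
      else if Q \<in> tangent (a m) then a m else third (?x Q) (a m))" for Q m
  have Q: "Q \<in> P" "Q \<noteq> pt" if "m \<in> ?K" "Q \<in> m" for Q m using that subP by auto
  have x: "?x Q \<in> C" "Q \<in> pencil_line (?x Q)" if "m \<in> ?K" "Q \<in> m" for Q m
    using pencil_index[OF Q[OF that]] by auto
  have x_pt: "?x Q = pt \<longleftrightarrow> Q \<in> ?T" if "m \<in> ?K" "Q \<in> m" for Q m
    using pencil_index_eq[OF Q[OF that] ptC] x(2)[OF that] by (auto simp: pencil_line_def)
  have x_inj: "Q = Q'" if m: "m \<in> ?K" and q: "Q \<in> m" "Q' \<in> m" "?x Q = ?x Q'" for Q Q' m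
    using line_unique[of m "pencil_line (?x Q)" Q Q'] x[OF m q(1)] x[OF m q(2)] q m
      pencil_line(1,2)[of "?x Q"] by auto
  have f_ne: "f Q m \<in> C \<and> f Q m \<noteq> ?x Q" if m: "m \<in> ?K" "Q \<in> m" for Q m
    using c[OF m(1)] x_pt[OF m] a[OF m(1)] ptC x(1)[OF m] third[OF x(1)[OF m] _ a(1,2)[OF m(1)]]
    unfolding f_def by auto
  \<comment> \<open>Basic colours of one class determine the index, and on \<open>m\<close> the
    index determines the point; so \<open>R m\<close> alone could have the basic colour
    \<open>c m\<close>.\<close>
  have third_ne_c: "third (?x Q) (a m) \<noteq> c m"
    if m: "m \<in> ?K" and q: "Q \<in> m" "Q \<notin> tangent (a m)" for Q m
  proof
    assume "third (?x Q) (a m) = c m"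
    then have "pole (?x Q) (a m) = R m"
      using other_inj[OF a(1)[OF m] pole(2)[OF x(1)[OF m q(1)] a(1)[OF m]] R(2)[OF m]]
      unfolding third_def c_def by blast
    then have "R m \<in> pencil_line (?x Q)" using pole(1)[OF x(1)[OF m q(1)] a(1)[OF m]] by simp
    then have "?x (R m) = ?x Q"
      using pencil_index_eq[OF Q[OF m R(1)[OF m]] x(1)[OF m q(1)]] by blast
    then have "R m = Q" using x_inj[OF m R(1)[OF m] q(1)] by blast
    then show False using R(2)[OF m] q(2) by blast
  qed
  \<comment> \<open>The third clause is reached at \<open>R m\<close> only away from the contact
    point; there its colour \<open>a m\<close> differs from the colour \<open>c m\<close> of
    \<open>X m\<close>.\<close>
  have x_R: "?x (R m) \<noteq> a m \<Longrightarrow> c m \<noteq> a m" if m: "m \<in> ?K" for m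
    using c(3)[OF m] pencil_index_eq[of "a m" "a m"] pencil_line(3)[OF a(1)[OF m]] a[OF m] subC
    by auto
  have c_only: "Q \<in> ?T" if m: "m \<in> ?K" "Q \<in> m" "f Q m = c m" for Q m
  proof (rule ccontr)
    assume QT: "Q \<notin> ?T"
    show False
    proof (cases "?x Q = a m")
      case True
      then show False using QT m(3) c(2)[OF m(1)] by (simp add: f_def)
    next
      case xa: False
      show False
      proof (cases "Q \<in> tangent (a m)")
        case True
        then have "a m = c m" using QT xa m(3) by (simp add: f_def)
        then show False using x_R[OF m(1)] R_eqI[OF m(1,2) True] xa by metis
      next
        case False
        then show False using QT xa m(3) third_ne_c[OF m(1,2) False] by (simp add: f_def)
      qed
    qed
  qed
  have f_line: "inj_on (\<lambda>Q. f Q m) m" if m: "m \<in> ?K" for m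
  proof (rule inj_onI)
    fix Q Q' assume q: "Q \<in> m" "Q' \<in> m" and eq: "f Q m = f Q' m"
    show "Q = Q'"
    proof (cases "Q \<in> ?T \<or> Q' \<in> ?T")
      case True
      then have "f Q m = c m \<or> f Q' m = c m" by (auto simp: f_def)
      then have "Q \<in> ?T" "Q' \<in> ?T" using c_only[OF m q(1)] c_only[OF m q(2)] eq by auto
      then show ?thesis using X_eqI[OF m q(1)] X_eqI[OF m q(2)] by simp
    next
      case False
      then have xpt: "?x Q \<noteq> pt" "?x Q' \<noteq> pt" using x_pt m q by auto
      note t = third[OF x(1)[OF m q(1)] xpt(1) a(1,2)[OF m]] third[OF x(1)[OF m q(2)] xpt(2) a(1,2)[OF m]]
      \<comment> \<open>Two different clauses cannot agree, since \<open>third\<close> takes neither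
        of the values \<open>pt\<close> and \<open>a m\<close>; the cases are the three clauses used
        twice.\<close>
      consider "?x Q = ?x Q'" | "Q \<in> tangent (a m)" "Q' \<in> tangent (a m)"
        | "third (?x Q) (a m) = third (?x Q') (a m)"
        using False eq t(2,3,7,8) a(2)[OF m] unfolding f_def by (metis (no_types, lifting))
      then show ?thesis
      proof cases
        case 1 then show ?thesis using x_inj[OF m q] by blast
      next
        case 2 then show ?thesis using R_eqI[OF m q(1)] R_eqI[OF m q(2)] by simp
      next
        case 3 then show ?thesis
          using third_inj_left[OF x(1)[OF m q(1)] x(1)[OF m q(2)] a(1,2)[OF m]] x_inj[OF m q] by blast
      qed
    qed
  qed
  have f_point: "inj_on (f Q) {m \<in> Ls. pt \<notin> m \<and> Q \<in> m}" for Q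
  proof (rule inj_onI)
    fix m m' assume "m \<in> {m \<in> Ls. pt \<notin> m \<and> Q \<in> m}" "m' \<in> {m \<in> Ls. pt \<notin> m \<and> Q \<in> m}"
      and eq: "f Q m = f Q m'"
    then have m: "m \<in> ?K" "m' \<in> ?K" and q: "Q \<in> m" "Q \<in> m'" by auto
    have line: "m = m'" if "p \<in> m" "p \<in> m'" "p \<noteq> Q" for p
      using line_unique[of m m' Q p] m q that by blast
    show "m = m'"
    proof (cases "Q \<in> ?T")
      case True
      then have XQ: "X m = Q" "X m' = Q" using X_eqI[OF m(1) q(1)] X_eqI[OF m(2) q(2)] by auto
      \<comment> \<open>The class depends on \<open>m\<close> only through \<open>X m\<close>, so it
        is the same for all lines through \<open>Q\<close> and only \<open>R m\<close> can tell them
        apart.\<close>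
      then have am: "a m = a m'" by (simp add: a_def b_def)
      have "c m = c m'" using eq True by (simp add: f_def)
      then have "R m = R m'"
        using other_inj[OF a(1)[OF m(1)] R(2)[OF m(1)]] R(2)[OF m(2)] am by (simp add: c_def)
      moreover have "R m \<noteq> Q" using R(2)[OF m(1)] Xa[OF m(1)] XQ by auto
      ultimately show ?thesis using line[of "R m"] R(1)[OF m(1)] R(1)[OF m(2)] by simp
    next
      case False
      have xQ: "?x Q \<in> C" "?x Q \<noteq> pt" "Q \<in> pencil_line (?x Q)"
        using x[OF m(1) q(1)] x_pt[OF m(1) q(1)] False by auto
      note t = third[OF xQ(1,2) a(1,2)[OF m(1)]] third[OF xQ(1,2) a(1,2)[OF m(2)]]
      note d1 = third_tangentD[OF xQ(1,2) a(1,2)[OF m(1)] _ xQ(3)]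
        and d2 = third_tangentD[OF xQ(1,2) a(1,2)[OF m(2)] _ xQ(3)]
      note ri = third_inj_right[OF xQ(1,2) a(1,2)[OF m(1)] _ a(1,2)[OF m(2)]]
      \<comment> \<open>The colour reveals the class: \<open>pt\<close> means that the class is the
        index of \<open>Q\<close>, and equal basic colours come from equal classes. A basic colour
        of one line equal to the class of the other would, by \<open>d1\<close> or
        \<open>d2\<close>, put \<open>Q\<close> on the tangent that the basic clause
        excludes.\<close>
      have am: "a m = a m'"
        using False eq t(2,3,7,8) a(2)[OF m(1)] a(2)[OF m(2)] d1 d2 ri unfolding f_def
        by (auto split: if_splits)
      then have "X m = X m'" using a_inj[OF m] by blast
      moreover have "X m \<noteq> Q" using False X(2)[OF m(1)] by auto
      ultimately show ?thesis using line[of "X m"] X(1)[OF m(1)] X(1)[OF m(2)] by simp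
    qed
  qed
  show ?thesis
    using f_line f_ne f_point by (intro exI[of _ f]) blast
qed

text \<open>Composition with \<open>pencil_line\<close> turns indices into colours: an index other
  than \<open>pencil_index Q\<close> gives a pencil line that avoids \<open>Q\<close>.\<close>

lemma ex_array:
  "\<exists>A. extremal_triple_array (n + 1) (n\<^sup>2) (n * (n + 1)) A \<and>
         symbols (n + 1) (n\<^sup>2) A = P - {pt} \<and>
         bij_betw (row_symbols (n\<^sup>2) A) {..<n + 1} {P - l | l. l \<in> Ls \<and> pt \<in> l} \<and>
         bij_betw (col_symbols (n + 1) A) {..<n\<^sup>2} {l \<in> Ls. pt \<notin> l}"
proof -
  obtain f where f_line: "\<forall>m\<in>Ls. pt \<notin> m \<longrightarrow> inj_on (\<lambda>Q. f Q m) m"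
    and f0: "\<forall>m\<in>Ls. pt \<notin> m \<longrightarrow> (\<forall>Q\<in>m. f Q m \<in> C \<and> f Q m \<noteq> pencil_index Q)"
    and f_point: "\<forall>Q. inj_on (f Q) {m \<in> Ls. pt \<notin> m \<and> Q \<in> m}"
    using ex_flag_index by (elim exE conjE) (rule that)
  have f: "f Q m \<in> C" "f Q m \<noteq> pencil_index Q" if "m \<in> Ls" "pt \<notin> m" "Q \<in> m" for Q m
    using f0 that by auto
  have inj: "c = d" if "c \<in> C" "d \<in> C" "pencil_line c = pencil_line d" for c d
  proof (cases "c = pt")
    case True
    then have "d \<in> tangent pt"
      using that(3) pencil_line(3)[OF that(2)] by (simp add: pencil_line_def)
    then show ?thesis using tangent_oval[OF ptC that(2)] True by simp
  next
    case False
    then show ?thesis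
      using pencil_line_inj[OF that(1,2) False] pencil_line(3)[OF that(1)] that(3) by simp
  qed
  show ?thesis
  proof (rule array_of_flag_colouring[where F = "\<lambda>Q m. pencil_line (f Q m)"])
    show "pt \<in> P" using ptC subC by blast
  next
    fix Q m assume m: "m \<in> Ls" "pt \<notin> m" and Q: "Q \<in> m"
    have "Q \<in> P" "Q \<noteq> pt" using m Q subP by auto
    then show "pencil_line (f Q m) \<in> Ls \<and> pt \<in> pencil_line (f Q m) \<and> Q \<notin> pencil_line (f Q m)"
      using f[OF m Q] pencil_line(1,2)[OF f(1)[OF m Q]] pencil_index_eq[of Q "f Q m"] by auto
  next
    fix m assume m: "m \<in> Ls" "pt \<notin> m"
    show "inj_on (\<lambda>Q. pencil_line (f Q m)) m"
      using f_line m f(1)[OF m] inj unfolding inj_on_def by simp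
  next
    fix Q show "inj_on (\<lambda>m. pencil_line (f Q m)) {m \<in> Ls. pt \<notin> m \<and> Q \<in> m}"
    proof (rule inj_onI)
      fix m m' assume m: "m \<in> {m \<in> Ls. pt \<notin> m \<and> Q \<in> m}" "m' \<in> {m \<in> Ls. pt \<notin> m \<and> Q \<in> m}"
        and eq: "pencil_line (f Q m) = pencil_line (f Q m')"
      have "f Q m = f Q m'" using inj[OF _ _ eq] f(1) m by simp
      then show "m = m'" using inj_onD[OF f_point[rule_format]] m by blast
    qed
  qed
qed

end

section \<open>From the design to its set of lines, and the marginals\<close>

text \<open>A block has two distinct points, and a repeated block would be counted twice among the
  blocks through them; so the multiset of blocks carries no more information than the set of
  lines.\<close>

lemma lines_of_projective_plane:
  assumes "projective_plane n \<Pi>"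
  shows "proj_plane (points \<Pi>) (lines \<Pi>) n" and "blocks \<Pi> = mset_set (lines \<Pi>)"
proof -
  have n: "n \<ge> 2" and fin: "finite (points \<Pi>)" and cardP: "card (points \<Pi>) = n\<^sup>2 + n + 1"
    and sub: "\<And>l. l \<in> lines \<Pi> \<Longrightarrow> l \<subseteq> points \<Pi>"
    and cardl: "\<And>l. l \<in> lines \<Pi> \<Longrightarrow> card l = n + 1"
    and one: "\<And>x y. x \<in> points \<Pi> \<Longrightarrow> y \<in> points \<Pi> \<Longrightarrow> x \<noteq> y \<Longrightarrow>
        size {# b \<in># blocks \<Pi>. x \<in> b \<and> y \<in> b #} = 1"
    using assms unfolding projective_plane_def two_design_def block_design_def by auto
  have single: "\<exists>k. {# b \<in># blocks \<Pi>. x \<in> b \<and> y \<in> b #} = {#k#}"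
    if "x \<in> points \<Pi>" "y \<in> points \<Pi>" "x \<noteq> y" for x y
    using one[OF that] by (simp add: size_1_singleton_mset)
  show "proj_plane (points \<Pi>) (lines \<Pi>) n"
  proof
    fix x y assume "x \<in> points \<Pi>" "y \<in> points \<Pi>" "x \<noteq> y"
    then obtain k where "{# b \<in># blocks \<Pi>. x \<in> b \<and> y \<in> b #} = {#k#}" using single by blast
    then have "k \<in># {# b \<in># blocks \<Pi>. x \<in> b \<and> y \<in> b #}" by simp
    then show "\<exists>l\<in>lines \<Pi>. x \<in> l \<and> y \<in> l" by auto
  next
    fix l m x y
    assume lm: "l \<in> lines \<Pi>" "m \<in> lines \<Pi>" and xy: "x \<noteq> y" "x \<in> l" "y \<in> l" "x \<in> m" "y \<in> m"
    then obtain k where k: "{# b \<in># blocks \<Pi>. x \<in> b \<and> y \<in> b #} = {#k#}"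
      using single sub by blast
    have "l \<in># {# b \<in># blocks \<Pi>. x \<in> b \<and> y \<in> b #}" "m \<in># {# b \<in># blocks \<Pi>. x \<in> b \<and> y \<in> b #}"
      using lm xy by auto
    then show "l = m" unfolding k by simp
  qed (use n fin cardP sub cardl in auto)
  have "count (blocks \<Pi>) l = 1" if l: "l \<in> lines \<Pi>" for l
  proof -
    have "finite l" "\<not> card l \<le> Suc 0" using cardl[OF l] n by (auto intro: card_ge_0_finite)
    then obtain x y where xy: "x \<in> l" "y \<in> l" "x \<noteq> y"
      using card_le_Suc0_iff_eq[of l] by blast
    then obtain k where k: "{# b \<in># blocks \<Pi>. x \<in> b \<and> y \<in> b #} = {#k#}"
      using single sub[OF l] by blast
    have "count {# b \<in># blocks \<Pi>. x \<in> b \<and> y \<in> b #} l = count (blocks \<Pi>) l"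
      using xy by simp
    then have "count (blocks \<Pi>) l \<le> 1" unfolding k by (cases "k = l") auto
    moreover have "count (blocks \<Pi>) l > 0" using l by simp
    ultimately show ?thesis by linarith
  qed
  then show "blocks \<Pi> = mset_set (lines \<Pi>)"
    by (intro multiset_eqI) (simp add: count_mset_set' not_in_iff)
qed

theorem theorem2p1:
  fixes \<Pi> :: "'a block_design" and n :: nat and pt :: 'a and C :: "'a set"
  assumes "projective_plane n \<Pi>"
    and "odd n"
    and "pt \<in> points \<Pi>"
    and "oval n \<Pi> C"
    and "pt \<in> C"
  shows "orderable (unordered_array \<Pi> pt) \<and>
    (\<exists>A. extremal_triple_array (n + 1) (n\<^sup>2) (n * (n + 1)) A \<and>
         symbols (n + 1) (n\<^sup>2) A = points \<Pi> - {pt} \<and>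
         marginals (n + 1) (n\<^sup>2) A = unordered_array \<Pi> pt \<and>
         bij_betw (row_symbols (n\<^sup>2) A) {..<n + 1}
           {points \<Pi> - l | l. l \<in> lines \<Pi> \<and> pt \<in> l} \<and>
         bij_betw (col_symbols (n + 1) A) {..<n\<^sup>2} {l \<in> lines \<Pi>. pt \<notin> l})"
proof -
  interpret proj_plane "points \<Pi>" "lines \<Pi>" n
    using lines_of_projective_plane(1)[OF assms(1)] .
  interpret oval_plane "points \<Pi>" "lines \<Pi>" n C pt
  proof
    show "odd n" "pt \<in> C" using assms by auto
    show "C \<subseteq> points \<Pi>" "card C = n + 1" using assms(4) unfolding oval_def by auto
    fix l x y z
    assume "l \<in> lines \<Pi>" "x \<in> C" "y \<in> C" "z \<in> C" "x \<in> l" "y \<in> l" "z \<in> l"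
    then show "x = y \<or> x = z \<or> y = z"
      using assms(4) unfolding oval_def collinear3_def by blast
  qed
  obtain A where A: "extremal_triple_array (n + 1) (n\<^sup>2) (n * (n + 1)) A"
    and sym: "symbols (n + 1) (n\<^sup>2) A = points \<Pi> - {pt}"
    and row: "bij_betw (row_symbols (n\<^sup>2) A) {..<n + 1} {points \<Pi> - l | l. l \<in> lines \<Pi> \<and> pt \<in> l}"
    and col: "bij_betw (col_symbols (n + 1) A) {..<n\<^sup>2} {l \<in> lines \<Pi>. pt \<notin> l}"
    using ex_array by blast
  note simple = lines_of_projective_plane(2)[OF assms(1)]
  have filter: "{# l \<in># blocks \<Pi>. p l #} = mset_set {l \<in> lines \<Pi>. p l}" for p
    using simple filter_mset_mset_set[OF finLs, of p] by metis
  \<comment> \<open>Complementation does not merge lines, so the multiset of complements has no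
    repetitions and can be compared with the bijectively enumerated rows.\<close>
  have "inj_on (\<lambda>l. points \<Pi> - l) {l \<in> lines \<Pi>. pt \<in> l}"
    by (rule inj_onI) (use subP in blast)
  then have compl: "image_mset (\<lambda>l. points \<Pi> - l) (mset_set {l \<in> lines \<Pi>. pt \<in> l})
      = mset_set {points \<Pi> - l | l. l \<in> lines \<Pi> \<and> pt \<in> l}"
    by (simp add: image_mset_mset_set Setcompr_eq_image image_Collect)
  have "image_mset (row_symbols (n\<^sup>2) A) (mset_set {..<n + 1})
      = mset_set {points \<Pi> - l | l. l \<in> lines \<Pi> \<and> pt \<in> l}"
    and "image_mset (col_symbols (n + 1) A) (mset_set {..<n\<^sup>2}) = mset_set {l \<in> lines \<Pi>. pt \<notin> l}"
    using row col image_mset_mset_set unfolding bij_betw_def by metis+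
  then have marg: "marginals (n + 1) (n\<^sup>2) A = unordered_array \<Pi> pt"
    unfolding marginals_def row_design_def col_design_def unordered_array_def sym filter compl
    by simp
  moreover have "orderable (unordered_array \<Pi> pt)"
    using A marg unfolding extremal_triple_array_def orderable_def by blast
  ultimately show ?thesis using A sym row col by blast
qed

end
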